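(* Let $v\ge1$, $n=2^v$, and let $x,y$ be integers with $0\le x\le n-1$, $-1\le y\le n-1$ and $x\le y+1$. Define $$\alpha^{\mathrm K}_{x,y}\;=\;m_{n-1}\to\bigvee_{\varepsilon\in E(x,y)}\Big(m_{n-1}\wedge\bigwedge_{i=0}^{n-1}\Diamond^{\varepsilon_i}m_i\Big),$$ where $E(x,y)=\{\varepsilon\in\{0,1\}^n:\varepsilon_{n-1}=0,\ \chi(\varepsilon)\le x\}\cup\{\varepsilon\in\{0,1\}^n:\varepsilon_{n-1}=1,\ \chi(\varepsilon)\le y+1\}$, and $\alpha^{\mathrm D}_{x,y}=\Diamond 1\wedge\alpha^{\mathrm K}_{x,y}$. Put $X=\infty$ if $x=y=n-1$ and $X=x$ otherwise; put $Y=\infty$ if $y=n-1$ and $Y=y$ otherwise. For a world $w$ of a Kripke frame $(W,R)$ let $o(w)$ be the number of worlds $w'\ne w$ with $wRw'$. Then for every Kripke frame $\mathscr F=(W,R)$: (a) $\alpha^{\mathrm K}_{x,y}$ is valid on $\mathscr F$ if and only if every $w\in W$ satisfies either ($w$ is not $R$-reflexive and $o(w)\le X$) or ($w$ is $R$-reflexive and $o(w)\le Y$); (b) $\alpha^{\mathrm D}_{x,y}$ is valid on $\mathscr F$ if and only if every $w\in W$ satisfies either ($w$ is not $R$-reflexive and $1\le o(w)\le X$) or ($w$ is $R$-reflexive and $o(w)\le Y$). Consequently $\mathbf{K}\oplus\alpha^{\mathrm K}_{x,y}$ and $\mathbf{K}\oplus\alpha^{\mathrm D}_{x,y}$ are the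 logics of the respective frame classes described in (a) and (b).
   Context: $p_0,\dots,p_{v-1}$ are propositional variables and $m_0,\dots,m_{n-1}$ is an enumeration of the $n=2^v$ Boolean minterms $\bigwedge_{k=0}^{v-1}\pm p_k$ with $m_{n-1}=p_0\wedge\dots\wedge p_{v-1}$. For $\varepsilon_i\in\{0,1\}$, $\Diamond^{1}m_i=\Diamond m_i$ and $\Diamond^{0}m_i=\neg\Diamond m_i$; $1$ denotes the constant true; for $\varepsilon\in\{0,1\}^n$, $\chi(\varepsilon)$ is the number of indices $i$ with $\varepsilon_i=1$. "$o(w)\le\infty$" is always true. $\mathbf{K}\oplus\alpha$ denotes the least normal modal logic containing $\alpha$; a formula is valid on a frame if it is true at every world under every valuation. *)

theory Defs
  imports Main "HOL-Library.Extended"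
begin

section \<open>Modal formulas\<close>

datatype fm =
    Var nat
  | Bot
  | And fm fm
  | Or fm fm
  | Imp fm fm
  | Box fm

abbreviation Neg :: "fm \<Rightarrow> fm" where
  "Neg \<phi> \<equiv> Imp \<phi> Bot"

abbreviation Top :: fm where
  "Top \<equiv> Neg Bot"

abbreviation Dia :: "fm \<Rightarrow> fm" where
  "Dia \<phi> \<equiv> Neg (Box (Neg \<phi>))"

fun Conj :: "fm list \<Rightarrow> fm" where
  "Conj [] = Top"
| "Conj [\<phi>] = \<phi>"
| "Conj (\<phi> # \<psi> # \<psi>s) = And \<phi> (Conj (\<psi> # \<psi>s))"

fun Disj :: "fm list \<Rightarrow> fm" where
  "Disj [] = Bot"
| "Disj [\<phi>] = \<phi>"
| "Disj (\<phi> # \<psi> # \<psi>s) = Or \<phi> (Disj (\<psi> # \<psi>s))"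

fun subst :: "(nat \<Rightarrow> fm) \<Rightarrow> fm \<Rightarrow> fm" where
  "subst \<sigma> (Var k) = \<sigma> k"
| "subst \<sigma> Bot = Bot"
| "subst \<sigma> (And \<phi> \<psi>) = And (subst \<sigma> \<phi>) (subst \<sigma> \<psi>)"
| "subst \<sigma> (Or \<phi> \<psi>) = Or (subst \<sigma> \<phi>) (subst \<sigma> \<psi>)"
| "subst \<sigma> (Imp \<phi> \<psi>) = Imp (subst \<sigma> \<phi>) (subst \<sigma> \<psi>)"
| "subst \<sigma> (Box \<phi>) = Box (subst \<sigma> \<phi>)"


section \<open>Kripke semantics\<close>

definition frame :: "'w set \<Rightarrow> ('w \<times> 'w) set \<Rightarrow> bool" where
  "frame W R \<longleftrightarrow> W \<noteq> {} \<and> R \<subseteq> W \<times> W"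

fun sat :: "('w \<times> 'w) set \<Rightarrow> (nat \<Rightarrow> 'w set) \<Rightarrow> 'w \<Rightarrow> fm \<Rightarrow> bool" where
  "sat R V w (Var k) \<longleftrightarrow> w \<in> V k"
| "sat R V w Bot \<longleftrightarrow> False"
| "sat R V w (And \<phi> \<psi>) \<longleftrightarrow> sat R V w \<phi> \<and> sat R V w \<psi>"
| "sat R V w (Or \<phi> \<psi>) \<longleftrightarrow> sat R V w \<phi> \<or> sat R V w \<psi>"
| "sat R V w (Imp \<phi> \<psi>) \<longleftrightarrow> (sat R V w \<phi> \<longrightarrow> sat R V w \<psi>)"
| "sat R V w (Box \<phi>) \<longleftrightarrow> (\<forall>u. (w, u) \<in> R \<longrightarrow> sat R V u \<phi>)"

definition valid :: "'w set \<Rightarrow> ('w \<times> 'w) set \<Rightarrow> fm \<Rightarrow> bool" where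
  "valid W R \<phi> \<longleftrightarrow> (\<forall>V. (\<forall>k. V k \<subseteq> W) \<longrightarrow> (\<forall>w\<in>W. sat R V w \<phi>))"

definition logic_of :: "('w set \<times> ('w \<times> 'w) set) set \<Rightarrow> fm set" where
  "logic_of C = {\<phi>. \<forall>(W, R)\<in>C. valid W R \<phi>}"


section \<open>Normal modal logics\<close>

text \<open>Truth-functional evaluation: variables and boxed formulas are the atoms.\<close>

fun peval :: "(fm \<Rightarrow> bool) \<Rightarrow> fm \<Rightarrow> bool" where
  "peval a (Var k) \<longleftrightarrow> a (Var k)"
| "peval a Bot \<longleftrightarrow> False"
| "peval a (And \<phi> \<psi>) \<longleftrightarrow> peval a \<phi> \<and> peval a \<psi>"
| "peval a (Or \<phi> \<psi>) \<longleftrightarrow> peval a \<phi> \<or> peval a \<psi>"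
| "peval a (Imp \<phi> \<psi>) \<longleftrightarrow> (peval a \<phi> \<longrightarrow> peval a \<psi>)"
| "peval a (Box \<phi>) \<longleftrightarrow> a (Box \<phi>)"

definition tautology :: "fm \<Rightarrow> bool" where
  "tautology \<phi> \<longleftrightarrow> (\<forall>a. peval a \<phi>)"

definition normal_logic :: "fm set \<Rightarrow> bool" where
  "normal_logic L \<longleftrightarrow>
     (\<forall>\<phi>. tautology \<phi> \<longrightarrow> \<phi> \<in> L) \<and>
     Imp (Box (Imp (Var 0) (Var 1))) (Imp (Box (Var 0)) (Box (Var 1))) \<in> L \<and>
     (\<forall>\<phi> \<psi>. Imp \<phi> \<psi> \<in> L \<longrightarrow> \<phi> \<in> L \<longrightarrow> \<psi> \<in> L) \<and>
     (\<forall>\<sigma> \<phi>. \<phi> \<in> L \<longrightarrow> subst \<sigma> \<phi> \<in> L) \<and>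
     (\<forall>\<phi>. \<phi> \<in> L \<longrightarrow> Box \<phi> \<in> L)"

definition K_plus :: "fm \<Rightarrow> fm set" where
  "K_plus \<alpha> = \<Inter>{L. normal_logic L \<and> \<alpha> \<in> L}"


section \<open>The axioms\<close>

definition minterm :: "nat \<Rightarrow> (nat \<Rightarrow> bool) \<Rightarrow> fm" where
  "minterm v s = Conj (map (\<lambda>k. if s k then Var k else Neg (Var k)) [0..<v])"

definition minterm_enumeration :: "nat \<Rightarrow> (nat \<Rightarrow> fm) \<Rightarrow> bool" where
  "minterm_enumeration v m \<longleftrightarrow>
     bij_betw m {..<2 ^ v} (range (minterm v)) \<and>
     m (2 ^ v - 1) = minterm v (\<lambda>_. True)"

text \<open>Vectors in \<open>{0, 1}\<^sup>n\<close> are Boolean lists of length \<open>n\<close>.\<close>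

definition chi :: "bool list \<Rightarrow> nat" where
  "chi e = card {i. i < length e \<and> e ! i}"

definition E :: "nat \<Rightarrow> int \<Rightarrow> int \<Rightarrow> bool list set" where
  "E n x y =
     {e. length e = n \<and> \<not> e ! (n - 1) \<and> int (chi e) \<le> x} \<union>
     {e. length e = n \<and> e ! (n - 1) \<and> int (chi e) \<le> y + 1}"

definition signed_Dia :: "bool \<Rightarrow> fm \<Rightarrow> fm" where
  "signed_Dia b \<phi> = (if b then Dia \<phi> else Neg (Dia \<phi>))"

text \<open>The disjunction over \<open>E n x y\<close> is taken in the order in which
  \<^const>\<open>List.n_lists\<close> lists all Boolean vectors of length \<open>n\<close>.\<close>

definition alpha_K :: "nat \<Rightarrow> (nat \<Rightarrow> fm) \<Rightarrow> int \<Rightarrow> int \<Rightarrow> fm" where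
  "alpha_K n m x y =
     Imp (m (n - 1))
       (Disj (map (\<lambda>e. And (m (n - 1)) (Conj (map (\<lambda>i. signed_Dia (e ! i) (m i)) [0..<n])))
                (filter (\<lambda>e. e \<in> E n x y) (List.n_lists n [False, True]))))"

definition alpha_D :: "nat \<Rightarrow> (nat \<Rightarrow> fm) \<Rightarrow> int \<Rightarrow> int \<Rightarrow> fm" where
  "alpha_D n m x y = And (Dia Top) (alpha_K n m x y)"


section \<open>The frame classes\<close>

definition out_number :: "('w \<times> 'w) set \<Rightarrow> 'w \<Rightarrow> int extended" where
  "out_number R w =
     (let S = {u. u \<noteq> w \<and> (w, u) \<in> R} in if finite S then Fin (int (card S)) else Pinf)"

definition X_bound :: "nat \<Rightarrow> int \<Rightarrow> int \<Rightarrow> int extended" where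
  "X_bound n x y = (if x = int n - 1 \<and> y = int n - 1 then Pinf else Fin x)"

definition Y_bound :: "nat \<Rightarrow> int \<Rightarrow> int extended" where
  "Y_bound n y = (if y = int n - 1 then Pinf else Fin y)"

definition frames_K :: "nat \<Rightarrow> int \<Rightarrow> int \<Rightarrow> ('w set \<times> ('w \<times> 'w) set) set" where
  "frames_K n x y = {(W, R). frame W R \<and>
     (\<forall>w\<in>W. ((w, w) \<notin> R \<and> out_number R w \<le> X_bound n x y) \<or>
             ((w, w) \<in> R \<and> out_number R w \<le> Y_bound n y))}"

definition frames_D :: "nat \<Rightarrow> int \<Rightarrow> int \<Rightarrow> ('w set \<times> ('w \<times> 'w) set) set" where
  "frames_D n x y = {(W, R). frame W R \<and>
     (\<forall>w\<in>W. ((w, w) \<notin> R \<and> Fin 1 \<le> out_number R w \<and> out_number R w \<le> X_bound n x y) \<or>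
             ((w, w) \<in> R \<and> out_number R w \<le> Y_bound n y))}"

end

theory Submission
  imports Defs "HOL-Library.Countable_Set"
begin

text \<open>Under a valuation, the axiom at \<open>w\<close> bounds the number of minterms realised among the
  successors of \<open>w\<close>. A violation of the frame condition at \<open>w\<close> is already visible on a finite
  set of successors, and collapsing all successors onto that set, with pairwise distinct minterms,
  refutes the axiom.

  The same collapse works in the canonical frame, because it can be performed by definable
  valuations: finitely many worlds are separated by formulas, and \<open>w\<close> is separated from its closed
  successor set if it is irreflexive. So the canonical frame satisfies the frame condition. Since the
  condition passes to subframes (seriality to those containing the witnesses for \<open>\<diamond>\<close>), a countable
  elementary subframe of the canonical model, embedded into the given infinite type, refutes any
  non-theorem.\<close>

section \<open>Ultrafilter worlds\<close>

definition prop_theory :: "fm set \<Rightarrow> bool" where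
  "prop_theory G \<longleftrightarrow> (\<forall>\<phi>. tautology \<phi> \<longrightarrow> \<phi> \<in> G) \<and> (\<forall>\<phi> \<psi>. Imp \<phi> \<psi> \<in> G \<longrightarrow> \<phi> \<in> G \<longrightarrow> \<psi> \<in> G)"

text \<open>Since \<open>peval\<close> consults only variables and boxed formulas, this says that
  \<open>M\<close> consists of exactly the formulas true under some truth assignment to those
  atoms.\<close>

definition ultra :: "fm set \<Rightarrow> bool" where
  "ultra M \<longleftrightarrow> (\<forall>\<psi>. peval (\<lambda>\<chi>. \<chi> \<in> M) \<psi> \<longleftrightarrow> \<psi> \<in> M)"

lemma prop_theory_tautology: "prop_theory G \<Longrightarrow> tautology \<phi> \<Longrightarrow> \<phi> \<in> G"
  by (simp add: prop_theory_def)

lemma prop_theory_mp: "prop_theory G \<Longrightarrow> Imp \<phi> \<psi> \<in> G \<Longrightarrow> \<phi> \<in> G \<Longrightarrow> \<psi> \<in> G"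
  unfolding prop_theory_def by blast

lemma ultra_simps:
  assumes "ultra M"
  shows "Bot \<notin> M" "And \<phi> \<psi> \<in> M \<longleftrightarrow> \<phi> \<in> M \<and> \<psi> \<in> M"
    "Or \<phi> \<psi> \<in> M \<longleftrightarrow> \<phi> \<in> M \<or> \<psi> \<in> M" "Imp \<phi> \<psi> \<in> M \<longleftrightarrow> (\<phi> \<in> M \<longrightarrow> \<psi> \<in> M)"
proof -
  have p: "\<chi> \<in> M \<longleftrightarrow> peval (\<lambda>\<chi>. \<chi> \<in> M) \<chi>" for \<chi>
    using assms unfolding ultra_def by blast
  show "Bot \<notin> M" using p[of Bot] by simp
  show "And \<phi> \<psi> \<in> M \<longleftrightarrow> \<phi> \<in> M \<and> \<psi> \<in> M" using p[of "And \<phi> \<psi>"] p[of \<phi>] p[of \<psi>] by simp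
  show "Or \<phi> \<psi> \<in> M \<longleftrightarrow> \<phi> \<in> M \<or> \<psi> \<in> M" using p[of "Or \<phi> \<psi>"] p[of \<phi>] p[of \<psi>] by simp
  show "Imp \<phi> \<psi> \<in> M \<longleftrightarrow> (\<phi> \<in> M \<longrightarrow> \<psi> \<in> M)" using p[of "Imp \<phi> \<psi>"] p[of \<phi>] p[of \<psi>] by simp
qed

text \<open>Zorn's lemma gives a theory maximal among those omitting \<beta>. Maximality puts
  \<open>Imp \<psi> \<beta>\<close> into it for every absent \<psi>, which makes membership respect
  every connective.\<close>

lemma ultra_ext:
  assumes "prop_theory G" and "\<beta> \<notin> G"
  obtains M where "ultra M" "G \<subseteq> M" "\<beta> \<notin> M"
proof -
  let ?A = "{H. prop_theory H \<and> G \<subseteq> H \<and> \<beta> \<notin> H}"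
  have "\<exists>M\<in>?A. \<forall>X\<in>?A. M \<subseteq> X \<longrightarrow> X = M"
  proof (rule subset_Zorn_nonempty)
    show "?A \<noteq> {}" using assms by blast
  next
    fix \<C> assume ne: "\<C> \<noteq> {}" and ch: "subset.chain ?A \<C>"
    have sub: "H \<in> \<C> \<Longrightarrow> H \<in> ?A" for H
      using ch unfolding subset.chain_def by blast
    have "\<psi> \<in> \<Union>\<C>" if imp: "Imp \<phi> \<psi> \<in> \<Union>\<C>" and phi: "\<phi> \<in> \<Union>\<C>" for \<phi> \<psi>
    proof -
      obtain H1 H2 where "H1 \<in> \<C>" "Imp \<phi> \<psi> \<in> H1" "H2 \<in> \<C>" "\<phi> \<in> H2" using imp phi by blast
      then obtain H where "H \<in> \<C>" "Imp \<phi> \<psi> \<in> H" "\<phi> \<in> H"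
        using ch unfolding subset_chain_def by blast
      with sub[of H] show ?thesis by (auto dest: prop_theory_mp)
    qed
    moreover have "\<phi> \<in> \<Union>\<C>" if "tautology \<phi>" for \<phi>
      using ne sub that by (auto simp: prop_theory_def)
    ultimately have "prop_theory (\<Union>\<C>)" unfolding prop_theory_def by blast
    then show "\<Union>\<C> \<in> ?A" using sub ne by blast
  qed
  then obtain M where M: "prop_theory M" "G \<subseteq> M" "\<beta> \<notin> M"
    and max: "\<And>H. prop_theory H \<Longrightarrow> M \<subseteq> H \<Longrightarrow> \<beta> \<notin> H \<Longrightarrow> H = M"
    by auto
  have taut: "\<psi> \<in> M" if "tautology \<psi>" for \<psi>
    using M(1) that by (rule prop_theory_tautology)
  note mp = prop_theory_mp[OF M(1)]
  have refuted: "Imp \<psi> \<beta> \<in> M" if "\<psi> \<notin> M" for \<psi>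
  proof (rule ccontr)
    assume n: "Imp \<psi> \<beta> \<notin> M"
    \<comment> \<open>The theory generated by \<open>M\<close> and \<psi>, in deduction-theorem
      form. As it omits \<beta>, it would have to equal \<open>M\<close>, although it contains
      \<psi>.\<close>
    let ?H = "{\<chi>. Imp \<psi> \<chi> \<in> M}"
    have "\<chi>' \<in> ?H" if "Imp \<chi> \<chi>' \<in> ?H" "\<chi> \<in> ?H" for \<chi> \<chi>'
    proof -
      have "Imp (Imp \<psi> (Imp \<chi> \<chi>')) (Imp (Imp \<psi> \<chi>) (Imp \<psi> \<chi>')) \<in> M"
        by (rule taut) (simp add: tautology_def)
      with that show ?thesis using mp by blast
    qed
    moreover have "\<chi> \<in> ?H" if "tautology \<chi>" for \<chi>
      using that by (auto intro!: taut simp: tautology_def)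
    ultimately have "prop_theory ?H" unfolding prop_theory_def by blast
    moreover have "M \<subseteq> ?H"
    proof
      fix \<chi> assume "\<chi> \<in> M"
      moreover have "Imp \<chi> (Imp \<psi> \<chi>) \<in> M" by (rule taut) (simp add: tautology_def)
      ultimately show "\<chi> \<in> ?H" using mp by blast
    qed
    ultimately have "?H = M" using n max by blast
    moreover have "Imp \<psi> \<psi> \<in> M" by (rule taut) (simp add: tautology_def)
    ultimately show False using that by blast
  qed
  \<comment> \<open>Rules with one premise are covered as well, by repeating that premise.\<close>
  have step: "\<chi> \<in> M" if "tautology (Imp \<phi> (Imp \<psi> \<chi>))" "\<phi> \<in> M" "\<psi> \<in> M" for \<phi> \<psi> \<chi>
    using taut[OF that(1)] that(2,3) mp by blast
  have bot: "Bot \<notin> M"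
    using step[of Bot Bot \<beta>] M(3) by (auto simp: tautology_def)
  have imp: "Imp \<phi> \<psi> \<in> M \<longleftrightarrow> (\<phi> \<in> M \<longrightarrow> \<psi> \<in> M)" for \<phi> \<psi>
  proof
    assume r: "\<phi> \<in> M \<longrightarrow> \<psi> \<in> M"
    show "Imp \<phi> \<psi> \<in> M"
    proof (cases "\<phi> \<in> M")
      case True
      then show ?thesis using r step[of \<psi> \<psi> "Imp \<phi> \<psi>"] by (auto simp: tautology_def)
    next
      case False
      \<comment> \<open>If \<open>Imp \<phi> \<psi>\<close> were absent, both \<phi> and
        \<open>Imp \<phi> \<psi>\<close> would imply \<beta> in \<open>M\<close>; a case distinction
        on \<phi> then yields \<beta> itself.\<close>
      show ?thesis
        using step[of "Imp \<phi> \<beta>" "Imp (Imp \<phi> \<psi>) \<beta>" \<beta>] refuted[OF False] refuted[of "Imp \<phi> \<psi>"] M(3)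
        by (auto simp: tautology_def)
    qed
  qed (use mp in blast)
  have conj: "And \<phi> \<psi> \<in> M \<longleftrightarrow> \<phi> \<in> M \<and> \<psi> \<in> M" for \<phi> \<psi>
    using step[of \<phi> \<psi> "And \<phi> \<psi>"] step[of "And \<phi> \<psi>" "And \<phi> \<psi>" \<phi>] step[of "And \<phi> \<psi>" "And \<phi> \<psi>" \<psi>]
    by (auto simp: tautology_def)
  have disj: "Or \<phi> \<psi> \<in> M \<longleftrightarrow> \<phi> \<in> M \<or> \<psi> \<in> M" for \<phi> \<psi>
  proof
    assume or: "Or \<phi> \<psi> \<in> M"
    have "\<psi> \<in> M" if "\<phi> \<notin> M"
      by (rule step[of "Or \<phi> \<psi>" "Neg \<phi>"]) (use or imp that in \<open>auto simp: tautology_def\<close>)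
    then show "\<phi> \<in> M \<or> \<psi> \<in> M" by blast
  next
    have "tautology (Imp \<phi> (Imp \<phi> (Or \<phi> \<psi>)))" "tautology (Imp \<psi> (Imp \<psi> (Or \<phi> \<psi>)))"
      by (simp_all add: tautology_def)
    then show "\<phi> \<in> M \<or> \<psi> \<in> M \<Longrightarrow> Or \<phi> \<psi> \<in> M" using step by blast
  qed
  have "peval (\<lambda>\<chi>. \<chi> \<in> M) \<psi> \<longleftrightarrow> \<psi> \<in> M" for \<psi>
    by (induction \<psi>) (simp_all add: bot imp conj disj)
  with M that show thesis unfolding ultra_def by blast
qed

text \<open>Distinct \<open>ultra\<close> sets are never included in one another, because a formula
  missing from one has its negation there. So \<open>s\<close> has, for each \<open>t\<close> in
  \<open>T\<close>, a formula that \<open>t\<close> lacks; the conjunction of these serves all of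
  \<open>T\<close>.\<close>

lemma ultra_separate_finite:
  assumes "finite T" "ultra s" "s \<notin> T" "\<forall>t\<in>T. ultra t"
  shows "\<exists>\<delta>\<in>s. \<forall>t\<in>T. \<delta> \<notin> t"
  using assms
proof (induction T)
  case empty
  then have "Top \<in> s" by (simp add: ultra_simps)
  then show ?case by blast
next
  case (insert t T)
  then obtain \<delta> where d: "\<delta> \<in> s" "\<forall>t\<in>T. \<delta> \<notin> t" by auto
  have "\<exists>\<gamma>\<in>s. \<gamma> \<notin> t"
  proof (rule ccontr)
    assume "\<not> ?thesis"
    then have "s \<subseteq> t" by blast
    moreover have "\<gamma> \<in> s" if "\<gamma> \<in> t" for \<gamma>
    proof (rule ccontr)
      assume "\<gamma> \<notin> s"
      then have "Neg \<gamma> \<in> t" using \<open>s \<subseteq> t\<close> insert.prems by (meson subsetD ultra_simps(4))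
      with that show False using insert.prems by (simp add: ultra_simps)
    qed
    ultimately have "s = t" by blast
    then show False using insert.prems by simp
  qed
  then obtain \<gamma> where "\<gamma> \<in> s" "\<gamma> \<notin> t" by blast
  then have "And \<delta> \<gamma> \<in> s" "\<forall>t\<in>insert t T. And \<delta> \<gamma> \<notin> t"
    using d insert.prems by (auto simp: ultra_simps)
  then show ?case by blast
qed

text \<open>A clopen retraction of the Stone space onto any finite nonempty set of points.\<close>

lemma definable_retraction:
  assumes "finite T" "T \<noteq> {}" "\<forall>t\<in>T. ultra t"
  shows "\<exists>r. (\<forall>t\<in>T. r t = t) \<and> (\<forall>u. r u \<in> T) \<and>
           (\<forall>A. \<exists>\<theta>. \<forall>u. ultra u \<longrightarrow> (\<theta> \<in> u \<longleftrightarrow> r u \<in> A))"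
  using assms
proof (induction T rule: finite_ne_induct)
  case (singleton s)
  have "\<exists>\<theta>. \<forall>u. ultra u \<longrightarrow> (\<theta> \<in> u \<longleftrightarrow> s \<in> A)" for A
    by (rule exI[of _ "if s \<in> A then Top else Bot"]) (simp add: ultra_simps)
  then show ?case by (intro exI[of _ "\<lambda>_. s"]) auto
next
  case (insert s T)
  then obtain r where r: "\<forall>t\<in>T. r t = t" "\<forall>u. r u \<in> T"
    "\<And>A. \<exists>\<theta>. \<forall>u. ultra u \<longrightarrow> (\<theta> \<in> u \<longleftrightarrow> r u \<in> A)" by auto
  obtain \<delta> where d: "\<delta> \<in> s" "\<forall>t\<in>T. \<delta> \<notin> t"
    using ultra_separate_finite[of T s] insert by auto
  \<comment> \<open>Only \<open>s\<close> among the points of \<open>insert s T\<close> contains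
    \<delta>. Redirecting all sets containing \<delta> to \<open>s\<close> therefore fixes
    \<open>s\<close> and changes nothing on \<open>T\<close>.\<close>
  let ?r = "\<lambda>u. if \<delta> \<in> u then s else r u"
  have "\<exists>\<theta>. \<forall>u. ultra u \<longrightarrow> (\<theta> \<in> u \<longleftrightarrow> ?r u \<in> A)" for A
  proof -
    obtain \<theta> where "\<forall>u. ultra u \<longrightarrow> (\<theta> \<in> u \<longleftrightarrow> r u \<in> A)" using r(3) by blast
    then show ?thesis
      by (intro exI[of _ "if s \<in> A then Or \<delta> \<theta> else And (Neg \<delta>) \<theta>"]) (auto simp: ultra_simps)
  qed
  then show ?case using r d by (intro exI[of _ ?r]) auto
qed

section \<open>Canonical frames\<close>

definition canon_worlds :: "fm set \<Rightarrow> fm set set" where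
  "canon_worlds L = {w. ultra w \<and> L \<subseteq> w}"

definition canon_rel :: "fm set \<Rightarrow> (fm set \<times> fm set) set" where
  "canon_rel L = {(w, u). w \<in> canon_worlds L \<and> u \<in> canon_worlds L \<and> (\<forall>\<gamma>. Box \<gamma> \<in> w \<longrightarrow> \<gamma> \<in> u)}"

lemma normal_logicD:
  assumes "normal_logic L"
  shows "prop_theory L" "\<phi> \<in> L \<Longrightarrow> subst \<sigma> \<phi> \<in> L" "\<phi> \<in> L \<Longrightarrow> Box \<phi> \<in> L"
    "Imp (Box (Imp \<phi> \<psi>)) (Imp (Box \<phi>) (Box \<psi>)) \<in> L"
proof -
  have sub: "\<phi> \<in> L \<Longrightarrow> subst \<sigma> \<phi> \<in> L" for \<sigma> \<phi>
    using assms unfolding normal_logic_def by blast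
  have "Imp (Box (Imp (Var 0) (Var 1))) (Imp (Box (Var 0)) (Box (Var 1))) \<in> L"
    using assms unfolding normal_logic_def by blast
  from sub[OF this, of "\<lambda>k. if k = 0 then \<phi> else \<psi>"]
  show "Imp (Box (Imp \<phi> \<psi>)) (Imp (Box \<phi>) (Box \<psi>)) \<in> L" by simp
  show "prop_theory L" using assms unfolding prop_theory_def normal_logic_def by blast
qed (use assms in \<open>unfold normal_logic_def, blast+\<close>)

text \<open>The formulas boxed in \<open>w\<close> form a propositional theory containing
  \<open>L\<close>: necessitation puts \<open>L\<close> into it, and axiom K closes it under modus
  ponens. Extending it while still omitting \<beta> gives the successor.\<close>

lemma canon_witness:
  assumes "normal_logic L" "w \<in> canon_worlds L" "Box \<beta> \<notin> w"
  obtains u where "(w, u) \<in> canon_rel L" "\<beta> \<notin> u"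
proof -
  let ?G = "{\<gamma>. Box \<gamma> \<in> w}"
  note L = normal_logicD[OF assms(1)]
  have w: "ultra w" "L \<subseteq> w" using assms(2) by (auto simp: canon_worlds_def)
  have LG: "L \<subseteq> ?G" using L(3) w(2) by blast
  have "\<psi> \<in> ?G" if "Imp \<phi> \<psi> \<in> ?G" "\<phi> \<in> ?G" for \<phi> \<psi>
    using L(4)[of \<phi> \<psi>] w that by (auto simp: ultra_simps)
  then have "prop_theory ?G"
    using LG prop_theory_tautology[OF L(1)] unfolding prop_theory_def by blast
  then obtain u where "ultra u" "?G \<subseteq> u" "\<beta> \<notin> u" using ultra_ext[of ?G \<beta>] assms(3) by blast
  with that[of u] LG assms(2) show thesis by (auto simp: canon_rel_def canon_worlds_def)
qed

text \<open>The generality has two uses: all canonical worlds with an arbitrary \<sigma> give the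
  definable valuations that constrain the canonical frame, and a countable \<open>W\<close> with
  \<sigma> = \<open>Var\<close> gives the countermodel.\<close>

lemma truth_lemma:
  assumes sub: "W \<subseteq> canon_worlds L"
    and wit: "\<And>w \<beta>. w \<in> W \<Longrightarrow> Box \<beta> \<notin> w \<Longrightarrow> \<exists>u\<in>W. (w, u) \<in> canon_rel L \<and> \<beta> \<notin> u"
  shows "w \<in> W \<Longrightarrow> sat (canon_rel L \<inter> W \<times> W) (\<lambda>k. {u \<in> W. \<sigma> k \<in> u}) w \<phi> \<longleftrightarrow> subst \<sigma> \<phi> \<in> w"
proof (induction \<phi> arbitrary: w)
  case (Box \<phi>)
  have "(\<forall>u. (w, u) \<in> canon_rel L \<inter> W \<times> W \<longrightarrow> subst \<sigma> \<phi> \<in> u) \<longleftrightarrow> Box (subst \<sigma> \<phi>) \<in> w"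
    using wit[OF Box.prems, of "subst \<sigma> \<phi>"] Box.prems by (auto simp: canon_rel_def)
  with Box show ?case by auto
qed (use sub in \<open>auto simp: canon_worlds_def ultra_simps\<close>)

lemma subst_Var [simp]: "subst Var \<phi> = \<phi>"
  by (induction \<phi>) auto

section \<open>Semantics of the axioms\<close>

text \<open>The valuation read pointwise: the trace of this set on \<open>{..<v}\<close> determines
  which minterm holds at \<open>u\<close>.\<close>

definition profile :: "(nat \<Rightarrow> 'w set) \<Rightarrow> 'w \<Rightarrow> nat set" where
  "profile V u = {k. u \<in> V k}"

lemma sat_Conj: "sat R V w (Conj \<phi>s) \<longleftrightarrow> (\<forall>\<phi>\<in>set \<phi>s. sat R V w \<phi>)"
  by (induction \<phi>s rule: Conj.induct) auto

lemma sat_Disj: "sat R V w (Disj \<phi>s) \<longleftrightarrow> (\<exists>\<phi>\<in>set \<phi>s. sat R V w \<phi>)"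
  by (induction \<phi>s rule: Disj.induct) auto

lemma sat_minterm: "sat R V w (minterm v s) \<longleftrightarrow> (\<forall>k<v. s k \<longleftrightarrow> k \<in> profile V w)"
proof -
  have "sat R V w (minterm v s) \<longleftrightarrow> (\<forall>k<v. sat R V w (if s k then Var k else Neg (Var k)))"
    unfolding minterm_def sat_Conj set_map ball_simps by (simp add: Ball_def)
  also have "\<dots> \<longleftrightarrow> (\<forall>k<v. s k \<longleftrightarrow> k \<in> profile V w)"
    by (auto simp: profile_def)
  finally show ?thesis .
qed

text \<open>Minterms are syntactically equal only if their signs agree below \<open>v\<close>, so
  the enumeration amounts to a bijection \<open>c\<close> onto the subsets of \<open>{..<v}\<close>.
  The full set codes the distinguished minterm.\<close>

lemma minterm_enumeration_code:
  assumes "minterm_enumeration v m"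
  obtains c where "bij_betw c {..<2 ^ v} (Pow {..<v})" "c (2 ^ v - 1) = {..<v}"
    "\<And>i. i < 2 ^ v \<Longrightarrow> m i = minterm v (\<lambda>k. k \<in> c i)"
proof -
  have bij: "bij_betw m {..<2 ^ v} (range (minterm v))"
    and last: "m (2 ^ v - 1) = minterm v (\<lambda>_. True)"
    using assms by (auto simp: minterm_enumeration_def)
  have minterm_eq: "minterm v s = minterm v t \<longleftrightarrow> (\<forall>k<v. s k \<longleftrightarrow> t k)" for s t
  proof
    assume "minterm v s = minterm v t"
    \<comment> \<open>In the one-point model where \<open>Var k\<close> is true iff
      \<open>s k\<close>, \<open>minterm v s\<close> holds, and \<open>minterm v t\<close> holds
      only if \<open>t\<close> agrees with \<open>s\<close> below \<open>v\<close>.\<close>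
    then have "sat {} (\<lambda>k. {u::unit. s k}) () (minterm v s) \<longleftrightarrow> sat {} (\<lambda>k. {u::unit. s k}) () (minterm v t)"
      by simp
    then show "\<forall>k<v. s k \<longleftrightarrow> t k" by (auto simp: sat_minterm profile_def)
  qed (auto simp: minterm_def intro!: arg_cong[of _ _ Conj])
  have "\<exists>s. m i = minterm v s" if "i < 2 ^ v" for i
    using bij that by (auto simp: bij_betw_def)
  then obtain s where s: "\<And>i. i < 2 ^ v \<Longrightarrow> m i = minterm v (s i)" by metis
  define c where "c i = {k. k < v \<and> s i k}" for i
  have m: "m i = minterm v (\<lambda>k. k \<in> c i)" if "i < 2 ^ v" for i
    using s[OF that] minterm_eq[of "s i" "\<lambda>k. k \<in> c i"] by (simp add: c_def)
  have "inj_on c {..<2 ^ v}"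
    using bij m by (intro inj_onI) (metis bij_betw_def inj_onD lessThan_iff)
  moreover have "c ` {..<2 ^ v} = Pow {..<v}"
  proof
    show "Pow {..<v} \<subseteq> c ` {..<2 ^ v}"
    proof
      fix P assume P: "P \<in> Pow {..<v}"
      have "minterm v (\<lambda>k. k \<in> P) \<in> m ` {..<2 ^ v}" using bij by (auto simp: bij_betw_def)
      then obtain i where i: "i < 2 ^ v" "minterm v (\<lambda>k. k \<in> P) = m i" by blast
      then have "\<forall>k<v. k \<in> P \<longleftrightarrow> k \<in> c i" using m[of i] minterm_eq by simp
      then have "P = c i" using P by (auto simp: c_def)
      with i show "P \<in> c ` {..<2 ^ v}" by blast
    qed
  qed (auto simp: c_def)
  moreover have "c (2 ^ v - 1) = {..<v}"
    using m[of "2 ^ v - 1"] last minterm_eq[of "\<lambda>_. True" "\<lambda>k. k \<in> c (2 ^ v - 1)"] by (auto simp: c_def)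
  ultimately show thesis using that m by (auto simp: bij_betw_def)
qed

text \<open>Each successor satisfies exactly one minterm, so the elements correspond to the minterms
  that are possible at \<open>w\<close>.\<close>

definition succ_profiles :: "nat \<Rightarrow> ('w \<times> 'w) set \<Rightarrow> (nat \<Rightarrow> 'w set) \<Rightarrow> 'w \<Rightarrow> nat set set" where
  "succ_profiles v R V w = (\<lambda>u. profile V u \<inter> {..<v}) ` (R `` {w})"

lemma sat_alpha_K:
  assumes "minterm_enumeration v m" "n = 2 ^ v"
  shows "sat R V w (alpha_K n m x y) \<longleftrightarrow>
    ({..<v} \<subseteq> profile V w \<longrightarrow>
      (if {..<v} \<in> succ_profiles v R V w then int (card (succ_profiles v R V w)) \<le> y + 1
       else int (card (succ_profiles v R V w)) \<le> x))"
proof -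
  let ?P = "succ_profiles v R V w"
  obtain c where c: "bij_betw c {..<n} (Pow {..<v})" "c (n - 1) = {..<v}"
    and m: "\<And>i. i < n \<Longrightarrow> m i = minterm v (\<lambda>k. k \<in> c i)"
    using minterm_enumeration_code assms by metis
  have n: "n - 1 < n" using assms by simp
  have sub: "c i \<subseteq> {..<v}" if "i < n" for i using c(1) that by (auto simp: bij_betw_def)
  have sat_m: "sat R V u (m i) \<longleftrightarrow> profile V u \<inter> {..<v} = c i" if "i < n" for u i
    using sub[OF that] by (auto simp: m[OF that] sat_minterm)
  have dia: "sat R V w (signed_Dia b (m i)) \<longleftrightarrow> (b \<longleftrightarrow> c i \<in> ?P)" if "i < n" for b i
    by (auto simp: signed_Dia_def sat_m[OF that] succ_profiles_def)
  \<comment> \<open>The vector of actual truth values of the formulas \<open>Dia (m i)\<close> at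
    \<open>w\<close>. The disjunct of any other vector fails, so the disjunction reduces to
    \<open>e \<in> E n x y\<close>.\<close>
  define e where "e = map (\<lambda>i. c i \<in> ?P) [0..<n]"
  have len: "length e = n" by (simp add: e_def)
  have last: "e ! (n - 1) \<longleftrightarrow> {..<v} \<in> ?P" using n c(2) by (simp add: e_def)
  have eq: "(\<forall>i<n. d ! i \<longleftrightarrow> c i \<in> ?P) \<longleftrightarrow> d = e" if "length d = n" for d
    using that by (simp add: e_def list_eq_iff_nth_eq)
  have "chi e = card {i \<in> {..<n}. c i \<in> ?P}"
    unfolding chi_def by (rule arg_cong[of _ _ card]) (auto simp: e_def)
  also have "\<dots> = card (c ` {i \<in> {..<n}. c i \<in> ?P})"
    using c(1) by (intro card_image[symmetric]) (auto simp: bij_betw_def inj_on_def)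
  also have "c ` {i \<in> {..<n}. c i \<in> ?P} = ?P \<inter> c ` {..<n}" by blast
  also have "\<dots> = ?P" using c(1) by (auto simp: bij_betw_def succ_profiles_def)
  finally have chi: "chi e = card ?P" .
  have "sat R V w (alpha_K n m x y) \<longleftrightarrow> (sat R V w (m (n - 1)) \<longrightarrow>
      (\<exists>d. length d = n \<and> d \<in> E n x y \<and> (\<forall>i<n. d ! i \<longleftrightarrow> c i \<in> ?P)))"
    using dia by (auto simp: alpha_K_def sat_Disj sat_Conj set_n_lists)
  also have "\<dots> \<longleftrightarrow> (sat R V w (m (n - 1)) \<longrightarrow> e \<in> E n x y)"
    using eq len by blast
  also have "e \<in> E n x y \<longleftrightarrow> (if {..<v} \<in> ?P then int (card ?P) \<le> y + 1 else int (card ?P) \<le> x)"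
    using last by (simp add: E_def chi len)
  also have "sat R V w (m (n - 1)) \<longleftrightarrow> {..<v} \<subseteq> profile V w"
    using sat_m[OF n] c(2) by auto
  finally show ?thesis .
qed

section \<open>The frame condition at a single world\<close>

definition out_bounded :: "nat \<Rightarrow> int \<Rightarrow> int \<Rightarrow> ('w \<times> 'w) set \<Rightarrow> 'w \<Rightarrow> bool" where
  "out_bounded n x y R w \<longleftrightarrow> ((w, w) \<notin> R \<and> out_number R w \<le> X_bound n x y) \<or>
                      ((w, w) \<in> R \<and> out_number R w \<le> Y_bound n y)"

lemma out_number_le_Fin:
  "out_number R w \<le> Fin b \<longleftrightarrow> finite (R `` {w} - {w}) \<and> int (card (R `` {w} - {w})) \<le> b"
proof -
  have "{u. u \<noteq> w \<and> (w, u) \<in> R} = R `` {w} - {w}" by auto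
  then show ?thesis by (simp add: out_number_def Let_def)
qed

lemma Fin_1_le_out_number: "(w, w) \<notin> R \<Longrightarrow> Fin 1 \<le> out_number R w \<longleftrightarrow> R `` {w} \<noteq> {}"
proof -
  assume "(w, w) \<notin> R"
  then have "{u. u \<noteq> w \<and> (w, u) \<in> R} = R `` {w}" by auto
  moreover have "finite A \<Longrightarrow> (1 \<le> int (card A)) = (A \<noteq> {})" for A :: "'a set"
    by (metis card_gt_0_iff int_one_le_iff_zero_less of_nat_0_less_iff)
  ultimately show ?thesis by (auto simp: out_number_def Let_def)
qed

text \<open>A reflexive world has itself as successor; at an irreflexive one the lower bound 1 says
  that some successor exists. The D condition is thus the K condition together with
  seriality.\<close>

lemma out_bounded_serial:
  "((w, w) \<notin> R \<and> Fin 1 \<le> out_number R w \<and> out_number R w \<le> X_bound n x y) \<or>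
     ((w, w) \<in> R \<and> out_number R w \<le> Y_bound n y) \<longleftrightarrow>
   out_bounded n x y R w \<and> R `` {w} \<noteq> {}"
  using Fin_1_le_out_number[of w R] by (auto simp: out_bounded_def)

text \<open>There are at most as many profiles as successors, which settles the finite bounds. Where
  a bound is \<open>Pinf\<close>, the total number of profiles already suffices.\<close>

lemma out_bounded_imp_sat:
  assumes m: "minterm_enumeration v m" "n = 2 ^ v" and xy: "x \<le> y + 1"
    and ok: "out_bounded n x y R w"
  shows "sat R V w (alpha_K n m x y)"
proof -
  let ?P = "succ_profiles v R V w"
  have PPow: "?P \<subseteq> Pow {..<v}" by (auto simp: succ_profiles_def)
  have cPow: "card (Pow {..<v}) = n" using m by (simp add: card_Pow)
  have cP: "card ?P \<le> n" using card_mono[OF _ PPow] cPow by simp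
  \<comment> \<open>This serves the case x = y = n - 1: without the full profile at most n - 1 = x
    profiles remain, and with it at most n = y + 1.\<close>
  have cP': "card ?P \<le> n - 1" if "{..<v} \<notin> ?P"
  proof -
    have "?P \<subseteq> Pow {..<v} - {{..<v}}" using PPow that by blast
    from card_mono[OF _ this] show ?thesis using cPow by (simp add: card_Diff_singleton)
  qed
  have n: "n \<ge> 1" using m by simp
  have bound: "card ?P \<le> card (R `` {w})" if "finite (R `` {w})"
    unfolding succ_profiles_def by (rule card_image_le[OF that])
  show ?thesis
  proof (cases "(w, w) \<in> R")
    case False
    then have le: "out_number R w \<le> X_bound n x y" using ok by (simp add: out_bounded_def)
    have "R `` {w} - {w} = R `` {w}" using False by auto
    then show ?thesis using le cP cP' n xy bound
      by (auto simp: sat_alpha_K[OF m] X_bound_def out_number_le_Fin split: if_splits)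
  next
    case True
    then have le: "out_number R w \<le> Y_bound n y" using ok by (simp add: out_bounded_def)
    \<comment> \<open>A reflexive \<open>w\<close> satisfying the antecedent realises the full
      profile itself. Hence the bound y + 1 applies, the extra 1 counting \<open>w\<close>.\<close>
    have full: "{..<v} \<in> ?P" if "{..<v} \<subseteq> profile V w"
      using True that by (force simp: succ_profiles_def)
    have "R `` {w} = insert w (R `` {w} - {w})" using True by auto
    then have "finite (R `` {w}) \<and> card (R `` {w}) = Suc (card (R `` {w} - {w}))"
      if "finite (R `` {w} - {w})"
      using that by (metis Diff_iff card_insert_disjoint finite_insert insertI1)
    then show ?thesis using le cP full bound
      by (auto simp: sat_alpha_K[OF m] Y_bound_def out_number_le_Fin split: if_splits)
  qed
qed

text \<open>The valuations in \<open>\<V>\<close> can collapse the successors of \<open>w\<close> onto any finite set of them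
  that reflects the reflexivity of \<open>w\<close>.\<close>

definition collapsing :: "('w \<times> 'w) set \<Rightarrow> (nat \<Rightarrow> 'w set) set \<Rightarrow> 'w \<Rightarrow> bool" where
  "collapsing R \<V> w \<longleftrightarrow>
     (\<forall>T g. finite T \<longrightarrow> T \<noteq> {} \<longrightarrow> T \<subseteq> R `` {w} \<longrightarrow> ((w, w) \<in> R \<longrightarrow> w \<in> T) \<longrightarrow>
        (\<exists>V\<in>\<V>. profile V w = g w \<and> profile V ` (R `` {w}) = g ` T))"

lemma subset_of_card_exists:
  assumes "\<not> (finite S \<and> int (card S) \<le> b)" "b \<ge> -1"
  obtains T where "T \<subseteq> S" "finite T" "int (card T) = b + 1"
proof (cases "finite S")
  case True
  then have "nat (b + 1) \<le> card S" using assms by simp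
  then obtain T where "T \<subseteq> S" "card T = nat (b + 1)" "finite T"
    by (rule obtain_subset_with_card_n)
  then show thesis using that assms by simp
next
  case False
  then obtain T where "finite T" "card T = nat (b + 1)" "T \<subseteq> S"
    by (meson infinite_arbitrarily_large)
  then show thesis using that assms by simp
qed

text \<open>A least violating set of successors is given pairwise distinct profiles, and
  \<open>w\<close> the full one; collapsing onto it refutes the axiom. The family
  \<open>\<V>\<close> is a parameter so that the argument covers both all valuations of a frame and
  the definable ones of the canonical frame.\<close>

lemma sat_imp_out_bounded:
  assumes m: "minterm_enumeration v m" "n = 2 ^ v"
    and x: "0 \<le> x" "x \<le> int n - 1" and y: "-1 \<le> y" "y \<le> int n - 1" and xy: "x \<le> y + 1"
    and col: "collapsing R \<V> w"
    and sat: "\<And>V. V \<in> \<V> \<Longrightarrow> sat R V w (alpha_K n m x y)"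
  shows "out_bounded n x y R w"
proof (rule ccontr)
  assume nok: "\<not> ?thesis"
  have cPow: "card (Pow {..<v}) = n" using m by (simp add: card_Pow)
  then have cPow': "card (Pow {..<v} - {{..<v}}) = n - 1" by (simp add: card_Diff_singleton)
  have n: "n \<ge> 1" using m by simp
  have key: "if {..<v} \<in> g ` T then int (card (g ` T)) \<le> y + 1 else int (card (g ` T)) \<le> x"
    if T: "finite T" "T \<noteq> {}" "T \<subseteq> R `` {w}" "(w, w) \<in> R \<Longrightarrow> w \<in> T"
      and g: "g w = {..<v}" "g ` T \<subseteq> Pow {..<v}" for T and g :: "'a \<Rightarrow> nat set"
  proof -
    obtain V where V: "V \<in> \<V>" "profile V w = g w" "profile V ` (R `` {w}) = g ` T"
      using col[unfolded collapsing_def, rule_format, of T g] T by blast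
    have "succ_profiles v R V w = (\<lambda>P. P \<inter> {..<v}) ` (profile V ` (R `` {w}))"
      by (simp add: succ_profiles_def image_image)
    also have "\<dots> = (\<lambda>P. P) ` g ` T"
      unfolding V(3) using g(2) by (intro image_cong) auto
    finally have P: "succ_profiles v R V w = g ` T" by simp
    show ?thesis using sat[OF V(1)] unfolding sat_alpha_K[OF m] P V(2) g(1) by blast
  qed
  show False
  proof (cases "(w, w) \<in> R")
    case False
    then have "\<not> out_number R w \<le> X_bound n x y" using nok by (simp add: out_bounded_def)
    then have not_top: "\<not> (x = int n - 1 \<and> y = int n - 1)"
      and many: "\<not> (finite (R `` {w} - {w}) \<and> int (card (R `` {w} - {w})) \<le> x)"
      by (auto simp: X_bound_def out_number_le_Fin split: if_splits)
    have "-1 \<le> x" using x(1) by simp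
    with many obtain T where T: "T \<subseteq> R `` {w} - {w}" "finite T" "int (card T) = x + 1"
      by (rule subset_of_card_exists)
    have ne: "T \<noteq> {}" using T(3) x(1) by auto
    have wT: "w \<notin> T" and TR: "T \<subseteq> R `` {w}" using T(1) by blast+
    show False
    proof (cases "x = int n - 1")
      \<comment> \<open>Here \<open>T\<close> has n elements, so distinct profiles must exhaust all
        n subsets, including the full one. The axiom then forces y = n - 1, the case where the bound
        is infinite.\<close>
      case True
      then have "card T = card (Pow {..<v})" using T cPow by simp
      then obtain h where h: "bij_betw h T (Pow {..<v})"
        using T(2) by (metis finite_Pow_iff finite_lessThan finite_same_card_bij)
      let ?g = "h(w := {..<v})"
      have "?g ` T = h ` T" using wT by (intro image_cong) auto
      then have g: "?g ` T = Pow {..<v}" using h by (simp add: bij_betw_def)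
      have "if {..<v} \<in> ?g ` T then int (card (?g ` T)) \<le> y + 1 else int (card (?g ` T)) \<le> x"
        by (rule key) (use T(2) ne TR False g in simp_all)
      then have "int n \<le> y + 1" unfolding g cPow by simp
      then show False using True not_top y by simp
    next
      case neq: False
      \<comment> \<open>Now the x + 1 successors fit into the n - 1 non-full profiles, so the bound
        x is the one that applies.\<close>
      then have "card T \<le> card (Pow {..<v} - {{..<v}})" using T x cPow' by simp
      then obtain h where h: "h ` T \<subseteq> Pow {..<v} - {{..<v}}" "inj_on h T"
        using T(2) by (metis card_le_inj finite_Diff finite_Pow_iff finite_lessThan)
      let ?g = "h(w := {..<v})"
      have g: "?g ` T = h ` T" using wT by (intro image_cong) auto
      have "if {..<v} \<in> ?g ` T then int (card (?g ` T)) \<le> y + 1 else int (card (?g ` T)) \<le> x"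
        by (rule key) (use T(2) ne TR False g h(1) in auto)
      moreover have "{..<v} \<notin> h ` T" using h(1) by blast
      ultimately have "int (card (h ` T)) \<le> x" unfolding g by simp
      then show False using T(3) h(2) by (simp add: card_image)
    qed
  next
    case True
    then have "\<not> out_number R w \<le> Y_bound n y" using nok by (simp add: out_bounded_def)
    then have ny: "y \<noteq> int n - 1"
      and many: "\<not> (finite (R `` {w} - {w}) \<and> int (card (R `` {w} - {w})) \<le> y)"
      by (auto simp: Y_bound_def out_number_le_Fin split: if_splits)
    obtain T where T: "T \<subseteq> R `` {w} - {w}" "finite T" "int (card T) = y + 1"
      using many y(1) by (rule subset_of_card_exists)
    \<comment> \<open>The y + 1 successors other than \<open>w\<close> receive distinct non-full
      profiles; \<open>w\<close> adds the full one, giving y + 2 in total.\<close>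
    then have "card T \<le> card (Pow {..<v} - {{..<v}})" using ny y cPow' by simp
    then obtain h where h: "h ` T \<subseteq> Pow {..<v} - {{..<v}}" "inj_on h T"
      using T(2) by (metis card_le_inj finite_Diff finite_Pow_iff finite_lessThan)
    let ?g = "h(w := {..<v})"
    have "w \<notin> T" using T(1) by blast
    then have "?g ` T = h ` T" by (intro image_cong) auto
    then have g: "?g ` insert w T = insert {..<v} (h ` T)" by (simp only: image_insert fun_upd_same)
    have "card (insert {..<v} (h ` T)) = Suc (card T)"
      using h T by (subst card_insert_disjoint) (auto simp: card_image)
    moreover have "if {..<v} \<in> ?g ` insert w T then int (card (?g ` insert w T)) \<le> y + 1
        else int (card (?g ` insert w T)) \<le> x"
    proof (rule key)
      show "insert w T \<subseteq> R `` {w}" using T(1) True by blast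
      show "?g ` insert w T \<subseteq> Pow {..<v}" unfolding g using h(1) by blast
    qed (use T(2) in simp_all)
    then have "int (card (insert {..<v} (h ` T))) \<le> y + 1" unfolding g by simp
    ultimately show False using T(3) by simp
  qed
qed

section \<open>Collapsing valuations on arbitrary and canonical frames\<close>

lemma all_valuations_collapsing:
  assumes "frame W R" "w \<in> W"
  shows "collapsing R {V. \<forall>k. V k \<subseteq> W} w"
  unfolding collapsing_def
proof (intro allI impI)
  fix T and g :: "'a \<Rightarrow> nat set"
  assume T: "finite T" "T \<noteq> {}" "T \<subseteq> R `` {w}" "(w, w) \<in> R \<longrightarrow> w \<in> T"
  obtain t where t: "t \<in> T" using T by blast
  \<comment> \<open>Keeping \<open>w\<close> fixed preserves its own profile. If \<open>w\<close>
    lies outside \<open>T\<close> it is irreflexive, so \<open>r\<close> still sends every successor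
    into \<open>T\<close>.\<close>
  define r where "r u = (if u \<in> insert w T then u else t)" for u
  define V where "V k = {u \<in> W. k \<in> g (r u)}" for k
  have prof: "profile V u = g (r u)" if "u \<in> W" for u using that by (auto simp: profile_def V_def)
  have RW: "R `` {w} \<subseteq> W" using assms by (auto simp: frame_def)
  have "r ` (R `` {w}) = T"
  proof
    show "r ` (R `` {w}) \<subseteq> T" using T t by (auto simp: r_def)
    show "T \<subseteq> r ` (R `` {w})" using T(3) by (force simp: r_def)
  qed
  moreover have "profile V ` (R `` {w}) = g ` r ` (R `` {w})"
    unfolding image_image using prof RW by (intro image_cong) auto
  moreover have "profile V w = g w" using prof[OF assms(2)] by (simp add: r_def)
  ultimately show "\<exists>V\<in>{V. \<forall>k. V k \<subseteq> W}. profile V w = g w \<and> profile V ` (R `` {w}) = g ` T"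
    by (intro bexI[of _ V]) (auto simp: V_def)
qed

text \<open>The successors of an irreflexive \<open>w\<close> form a closed set not containing \<open>w\<close>, so a
  single formula separates \<open>w\<close> from all of them, even if there are infinitely many.\<close>

lemma canon_collapsing:
  assumes w: "w \<in> canon_worlds L"
  shows "collapsing (canon_rel L) {\<lambda>k. {u \<in> canon_worlds L. \<sigma> k \<in> u} |\<sigma>. True} w"
  unfolding collapsing_def
proof (intro allI impI)
  let ?R = "canon_rel L"
  fix T and g :: "fm set \<Rightarrow> nat set"
  assume T: "finite T" "T \<noteq> {}" "T \<subseteq> ?R `` {w}" "(w, w) \<in> ?R \<longrightarrow> w \<in> T"
  have R: "?R `` {w} \<subseteq> canon_worlds L" by (auto simp: canon_rel_def)
  have ul: "ultra u" if "u \<in> canon_worlds L" for u using that by (auto simp: canon_worlds_def)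
  have Tu: "\<forall>t\<in>T. ultra t" using T(3) R ul by blast
  obtain r where r: "\<forall>t\<in>T. r t = t" "\<forall>u. r u \<in> T"
    and def: "\<And>A. \<exists>\<theta>. \<forall>u. ultra u \<longrightarrow> (\<theta> \<in> u \<longleftrightarrow> r u \<in> A)"
    using definable_retraction[OF T(1,2) Tu] by blast
  have "\<forall>k. \<exists>\<theta>. \<forall>u. ultra u \<longrightarrow> (\<theta> \<in> u \<longleftrightarrow> k \<in> g (r u))"
  proof
    show "\<exists>\<theta>. \<forall>u. ultra u \<longrightarrow> (\<theta> \<in> u \<longleftrightarrow> k \<in> g (r u))" for k
      using def[of "{t. k \<in> g t}"] by simp
  qed
  then obtain \<theta> where \<theta>: "\<And>k u. ultra u \<Longrightarrow> \<theta> k \<in> u \<longleftrightarrow> k \<in> g (r u)" by metis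
  have im: "r ` (?R `` {w}) = T"
  proof
    show "r ` (?R `` {w}) \<subseteq> T" by (rule image_subsetI) (simp add: r(2))
    show "T \<subseteq> r ` (?R `` {w})"
    proof
      fix t assume "t \<in> T"
      with T(3) r(1) show "t \<in> r ` (?R `` {w})" by (intro rev_image_eqI[of t]) auto
    qed
  qed
  have "\<exists>\<sigma>. (\<forall>u\<in>?R `` {w}. \<forall>k. \<sigma> k \<in> u \<longleftrightarrow> k \<in> g (r u)) \<and> (\<forall>k. \<sigma> k \<in> w \<longleftrightarrow> k \<in> g w)"
  proof (cases "(w, w) \<in> ?R")
    case True
    then have "r w = w" using T(4) r(1) by blast
    then show ?thesis using \<theta> R ul w by (intro exI[of _ \<theta>]) auto
  next
    case False
    then obtain \<beta> where \<beta>: "Box \<beta> \<in> w" "\<beta> \<notin> w" using w by (auto simp: canon_rel_def)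
    have "\<beta> \<in> u" if "u \<in> ?R `` {w}" for u using that \<beta>(1) by (auto simp: canon_rel_def)
    \<comment> \<open>At the successors \<beta> is true, so both formulas agree there with
      \<open>\<theta> k\<close>. At \<open>w\<close> it is false, making the implication true and
      the conjunction false, as \<open>g w\<close> prescribes.\<close>
    then show ?thesis using \<theta> R ul w \<beta>
      by (intro exI[of _ "\<lambda>k. if k \<in> g w then Imp \<beta> (\<theta> k) else And \<beta> (\<theta> k)"])
        (auto simp: ultra_simps subset_iff)
  qed
  then obtain \<sigma> where \<sigma>: "\<And>u k. u \<in> ?R `` {w} \<Longrightarrow> \<sigma> k \<in> u \<longleftrightarrow> k \<in> g (r u)" "\<And>k. \<sigma> k \<in> w \<longleftrightarrow> k \<in> g w"
    by blast
  let ?V = "\<lambda>k. {u \<in> canon_worlds L. \<sigma> k \<in> u}"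
  have "profile ?V ` (?R `` {w}) = g ` r ` (?R `` {w})"
    unfolding image_image using \<sigma>(1) R by (intro image_cong) (auto simp: profile_def)
  then have "profile ?V ` (?R `` {w}) = g ` T" by (simp only: im)
  moreover have "profile ?V w = g w" using \<sigma>(2) w by (auto simp: profile_def)
  ultimately show "\<exists>V\<in>{\<lambda>k. {u \<in> canon_worlds L. \<sigma> k \<in> u} |\<sigma>. True}.
      profile V w = g w \<and> profile V ` (?R `` {w}) = g ` T" by blast
qed

text \<open>Under a definable valuation, truth of the axiom at \<open>w\<close> means membership in
  \<open>w\<close> of a substitution instance, and \<open>L\<close> contains all such
  instances.\<close>

lemma canon_out_bounded:
  assumes "minterm_enumeration v m" "n = 2 ^ v"
    and "0 \<le> x" "x \<le> int n - 1" "-1 \<le> y" "y \<le> int n - 1" "x \<le> y + 1"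
    and L: "normal_logic L" "alpha_K n m x y \<in> L" and w: "w \<in> canon_worlds L"
  shows "out_bounded n x y (canon_rel L) w"
proof (rule sat_imp_out_bounded[OF assms(1-7) canon_collapsing[OF w]])
  fix V :: "nat \<Rightarrow> fm set set"
  assume "V \<in> {\<lambda>k. {u \<in> canon_worlds L. \<sigma> k \<in> u} |\<sigma>. True}"
  then obtain \<sigma> where V: "V = (\<lambda>k. {u \<in> canon_worlds L. \<sigma> k \<in> u})" by blast
  have R: "canon_rel L \<inter> canon_worlds L \<times> canon_worlds L = canon_rel L"
    by (auto simp: canon_rel_def)
  have "\<exists>u\<in>canon_worlds L. (w, u) \<in> canon_rel L \<and> \<beta> \<notin> u"
    if w: "w \<in> canon_worlds L" and \<beta>: "Box \<beta> \<notin> w" for w \<beta>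
  proof -
    obtain u where "(w, u) \<in> canon_rel L" "\<beta> \<notin> u" by (rule canon_witness[OF L(1) w \<beta>])
    then show ?thesis by (auto simp: canon_rel_def)
  qed
  from truth_lemma[OF order_refl this w, of \<sigma> "alpha_K n m x y"]
  have "sat (canon_rel L) V w (alpha_K n m x y) \<longleftrightarrow> subst \<sigma> (alpha_K n m x y) \<in> w"
    unfolding R V by simp
  moreover have "subst \<sigma> (alpha_K n m x y) \<in> L" by (rule normal_logicD(2)[OF L])
  ultimately show "sat (canon_rel L) V w (alpha_K n m x y)" using w by (auto simp: canon_worlds_def)
qed

section \<open>Countable models\<close>

instance fm :: countable by countable_datatype

lemma countable_canon_submodel:
  assumes L: "normal_logic L" and \<phi>: "\<phi> \<notin> L"
  obtains W w where "countable W" "W \<subseteq> canon_worlds L" "w \<in> W" "\<phi> \<notin> w"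
    "\<And>w \<beta>. w \<in> W \<Longrightarrow> Box \<beta> \<notin> w \<Longrightarrow> \<exists>u\<in>W. (w, u) \<in> canon_rel L \<and> \<beta> \<notin> u"
proof -
  obtain w0 where w0: "ultra w0" "L \<subseteq> w0" "\<phi> \<notin> w0"
    using ultra_ext[OF normal_logicD(1)[OF L] \<phi>] .
  have "\<exists>u. u \<in> canon_worlds L \<and> (Box \<beta> \<notin> w \<longrightarrow> (w, u) \<in> canon_rel L \<and> \<beta> \<notin> u)"
    if w: "w \<in> canon_worlds L" for w \<beta>
  proof (cases "Box \<beta> \<in> w")
    case False
    obtain u where "(w, u) \<in> canon_rel L" "\<beta> \<notin> u" by (rule canon_witness[OF L w False])
    then show ?thesis by (auto simp: canon_rel_def)
  qed (use w in blast)
  then have "\<forall>\<beta> w. \<exists>u. w \<in> canon_worlds L \<longrightarrow> u \<in> canon_worlds L \<and>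
      (Box \<beta> \<notin> w \<longrightarrow> (w, u) \<in> canon_rel L \<and> \<beta> \<notin> u)" by blast
  then obtain s where s: "\<And>w \<beta>. w \<in> canon_worlds L \<Longrightarrow> s \<beta> w \<in> canon_worlds L"
    "\<And>w \<beta>. w \<in> canon_worlds L \<Longrightarrow> Box \<beta> \<notin> w \<Longrightarrow> (w, s \<beta> w) \<in> canon_rel L \<and> \<beta> \<notin> s \<beta> w"
    by metis
  \<comment> \<open>The worlds reached from \<open>w0\<close> by finitely many choices of witness.
    They are indexed by lists of formulas, hence countable in number.\<close>
  let ?W = "range (\<lambda>\<beta>s. foldr s \<beta>s w0)"
  have foldr: "foldr s \<beta>s w0 \<in> canon_worlds L" for \<beta>s
    by (induction \<beta>s) (use w0 s(1) in \<open>auto simp: canon_worlds_def\<close>)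
  show thesis
  proof (rule that)
    show "countable ?W" by simp
    show "?W \<subseteq> canon_worlds L" using foldr by blast
    show "w0 \<in> ?W" by (rule range_eqI[of _ _ "[]"]) simp
    show "\<phi> \<notin> w0" by (rule w0)
  next
    fix w \<beta> assume "w \<in> ?W" and b: "Box \<beta> \<notin> w"
    then obtain \<beta>s where w: "w = foldr s \<beta>s w0" by blast
    have "s \<beta> w \<in> ?W" by (rule range_eqI[of _ _ "\<beta> # \<beta>s"]) (simp add: w)
    then show "\<exists>u\<in>?W. (w, u) \<in> canon_rel L \<and> \<beta> \<notin> u"
      using s(2)[OF _ b] foldr w by blast
  qed
qed

section \<open>Transfer of the condition to subframes and injective copies\<close>

lemma out_bounded_subrel:
  assumes "out_bounded n x y R w" "R' \<subseteq> R" "(w, w) \<in> R' \<longleftrightarrow> (w, w) \<in> R"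
  shows "out_bounded n x y R' w"
proof -
  have "R' `` {w} - {w} \<subseteq> R `` {w} - {w}" using assms(2) by blast
  then have "out_number R w \<le> Fin b \<Longrightarrow> out_number R' w \<le> Fin b" for b
    unfolding out_number_le_Fin by (meson card_mono finite_subset le_trans of_nat_le_iff order_trans)
  \<comment> \<open>Losing successors preserves either upper bound; equal reflexivity ensures that
    the same bound still applies.\<close>
  then show ?thesis using assms(1,3) by (auto simp: out_bounded_def X_bound_def Y_bound_def)
qed

lemma map_prod_image_iff:
  assumes "inj_on f W" "R \<subseteq> W \<times> W" "w \<in> W"
  shows "(f w, u) \<in> map_prod f f ` R \<longleftrightarrow> (\<exists>u'\<in>W. (w, u') \<in> R \<and> u = f u')"
proof
  assume "(f w, u) \<in> map_prod f f ` R"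
  then obtain a b where ab: "(a, b) \<in> R" "f w = f a" "u = f b" by auto
  then have "w = a" using assms by (meson inj_onD mem_Sigma_iff subsetD)
  with ab assms(2) show "\<exists>u'\<in>W. (w, u') \<in> R \<and> u = f u'" by blast
qed auto

lemma out_bounded_inj_image:
  assumes "inj_on f W" "R \<subseteq> W \<times> W" "w \<in> W" "out_bounded n x y R w"
  shows "out_bounded n x y (map_prod f f ` R) (f w)"
proof -
  note iff = map_prod_image_iff[OF assms(1-3)]
  have refl: "(f w, f w) \<in> map_prod f f ` R \<longleftrightarrow> (w, w) \<in> R"
    using iff assms(1,3) by (auto dest: inj_onD)
  have sub: "R `` {w} - {w} \<subseteq> W" using assms(2) by blast
  have im: "(map_prod f f ` R) `` {f w} - {f w} = f ` (R `` {w} - {w})"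
    using iff assms(1-3) by (auto simp: Image_def dest: inj_onD)
  have inj: "inj_on f (R `` {w} - {w})" using inj_on_subset[OF assms(1) sub] .
  have "out_number (map_prod f f ` R) (f w) \<le> Fin b \<longleftrightarrow> out_number R w \<le> Fin b" for b
    unfolding out_number_le_Fin im using inj by (simp add: finite_image_iff card_image)
  with assms(4) show ?thesis by (simp add: out_bounded_def X_bound_def Y_bound_def refl) (auto split: if_splits)
qed

lemma sat_inj_image:
  assumes "inj_on f W" "R \<subseteq> W \<times> W" "\<And>k. V k \<subseteq> W"
  shows "w \<in> W \<Longrightarrow> sat (map_prod f f ` R) (\<lambda>k. f ` V k) (f w) \<phi> \<longleftrightarrow> sat R V w \<phi>"
proof (induction \<phi> arbitrary: w)
  case (Var k)
  then show ?case using inj_on_image_mem_iff[OF assms(1)] assms(3) by simp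
next
  case (Box \<phi>)
  note iff = map_prod_image_iff[OF assms(1,2) Box.prems]
  have succ: "u \<in> W" if "(w, u) \<in> R" for u using that assms(2) by blast
  have "sat (map_prod f f ` R) (\<lambda>k. f ` V k) (f w) (Box \<phi>) \<longleftrightarrow>
      (\<forall>u\<in>W. (w, u) \<in> R \<longrightarrow> sat (map_prod f f ` R) (\<lambda>k. f ` V k) (f u) \<phi>)"
    unfolding sat.simps iff by blast
  also have "\<dots> \<longleftrightarrow> sat R V w (Box \<phi>)" using Box.IH succ by auto
  finally show ?case .
qed auto

text \<open>Stated for any normal logic containing \<open>alpha_K\<close>, so that it serves both
  completeness claims; membership of \<open>Dia Top\<close> adds seriality. An injection of the
  countable submodel into \<open>'w\<close> carries the refutation over.\<close>

lemma countermodel: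
  assumes "minterm_enumeration v m" "n = 2 ^ v"
    and "0 \<le> x" "x \<le> int n - 1" "-1 \<le> y" "y \<le> int n - 1" "x \<le> y + 1"
    and L: "normal_logic L" "alpha_K n m x y \<in> L" and \<phi>: "\<phi> \<notin> L"
    and inf: "infinite (UNIV :: 'w set)"
  obtains W :: "'w set" and R where "frame W R" "\<forall>w\<in>W. out_bounded n x y R w"
    "Dia Top \<in> L \<longrightarrow> (\<forall>w\<in>W. R `` {w} \<noteq> {})" "\<not> valid W R \<phi>"
proof -
  obtain C w where C: "countable C" "C \<subseteq> canon_worlds L" "w \<in> C" "\<phi> \<notin> w"
    and wit: "\<And>w \<beta>. w \<in> C \<Longrightarrow> Box \<beta> \<notin> w \<Longrightarrow> \<exists>u\<in>C. (w, u) \<in> canon_rel L \<and> \<beta> \<notin> u"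
    using countable_canon_submodel[OF L(1) \<phi>] by blast
  obtain h :: "nat \<Rightarrow> 'w" where h: "inj h" using infinite_countable_subset[OF inf] by blast
  define f where "f = h \<circ> to_nat_on C"
  have f: "inj_on f C"
    unfolding f_def using C(1) h by (intro comp_inj_on) (auto intro: inj_on_subset)
  let ?R = "canon_rel L \<inter> C \<times> C" and ?V = "\<lambda>k. {u \<in> C. Var k \<in> u}"
  have R: "?R \<subseteq> C \<times> C" by blast
  show thesis
  proof (rule that)
    show "frame (f ` C) (map_prod f f ` ?R)" using C(3) by (auto simp: frame_def)
    have "out_bounded n x y (map_prod f f ` ?R) (f u)" if u: "u \<in> C" for u
    proof -
      have "out_bounded n x y (canon_rel L) u"
        using canon_out_bounded[OF assms(1-7) L] u C(2) by blast
      then have "out_bounded n x y ?R u" by (rule out_bounded_subrel) (use u in auto)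
      then show ?thesis by (rule out_bounded_inj_image[OF f R u])
    qed
    then show "\<forall>w\<in>f ` C. out_bounded n x y (map_prod f f ` ?R) w" by blast
    have "(map_prod f f ` ?R) `` {f u} \<noteq> {}" if D: "Dia Top \<in> L" and u: "u \<in> C" for u
    proof -
      have "Dia Top \<in> u" "ultra u" using D u C(2) by (auto simp: canon_worlds_def)
      \<comment> \<open>\<open>Dia Top\<close> is a negated box, so closure of \<open>C\<close>
        under witnesses provides a successor inside \<open>C\<close>.\<close>
      then have "Box (Neg Top) \<notin> u" by (simp add: ultra_simps)
      then obtain u' where "u' \<in> C" "(u, u') \<in> ?R" using wit u by blast
      then show ?thesis by force
    qed
    then show "Dia Top \<in> L \<longrightarrow> (\<forall>w\<in>f ` C. (map_prod f f ` ?R) `` {w} \<noteq> {})" by blast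
    have "\<not> sat ?R ?V w \<phi>"
      using truth_lemma[OF C(2) wit C(3), of Var \<phi>] C(4) by simp
    then have "\<not> sat (map_prod f f ` ?R) (\<lambda>k. f ` ?V k) (f w) \<phi>"
      using sat_inj_image[OF f R _ C(3), of ?V] by blast
    then show "\<not> valid (f ` C) (map_prod f f ` ?R) \<phi>"
      unfolding valid_def using C(3) by (auto intro!: exI[of _ "\<lambda>k. f ` ?V k"] bexI[of _ w])
  qed
qed

section \<open>Soundness\<close>

lemma peval_sat: "peval (sat R V w) \<phi> \<longleftrightarrow> sat R V w \<phi>"
  by (induction \<phi>) auto

text \<open>Substitution is absorbed into the valuation by letting each variable denote the truth
  set of its substitute, cut down to \<open>W\<close>.\<close>

lemma sat_subst:
  assumes "R \<subseteq> W \<times> W"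
  shows "w \<in> W \<Longrightarrow> sat R V w (subst \<sigma> \<phi>) \<longleftrightarrow> sat R (\<lambda>k. {u \<in> W. sat R V u (\<sigma> k)}) w \<phi>"
  by (induction \<phi> arbitrary: w) (use assms in auto)

lemma normal_logic_logic_of:
  assumes "\<And>W R. (W, R) \<in> C \<Longrightarrow> frame W R"
  shows "normal_logic (logic_of C)"
proof -
  have taut: "valid W R \<phi>" if "tautology \<phi>" for W :: "'a set" and R \<phi>
    using that peval_sat unfolding valid_def tautology_def by metis
  have sub: "valid W R (subst \<sigma> \<phi>)" if "frame W R" "valid W R \<phi>" for W :: "'a set" and R \<sigma> \<phi>
    using that sat_subst[of R W] by (auto simp: frame_def valid_def)
  have nec: "valid W R (Box \<phi>)" if "frame W R" "valid W R \<phi>" for W :: "'a set" and R \<phi>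
    using that by (auto simp: frame_def valid_def)
  have mp: "valid W R \<psi>" if "valid W R (Imp \<phi> \<psi>)" "valid W R \<phi>" for W :: "'a set" and R \<phi> \<psi>
    using that by (auto simp: valid_def)
  have K: "valid W R (Imp (Box (Imp (Var 0) (Var 1))) (Imp (Box (Var 0)) (Box (Var 1))))"
    for W :: "'a set" and R by (auto simp: valid_def)
  have "\<psi> \<in> logic_of C" if "Imp \<phi> \<psi> \<in> logic_of C" "\<phi> \<in> logic_of C" for \<phi> \<psi>
    using that mp by (fastforce simp: logic_of_def)
  moreover have "subst \<sigma> \<phi> \<in> logic_of C" "Box \<phi> \<in> logic_of C" if "\<phi> \<in> logic_of C" for \<sigma> \<phi>
    using that sub nec assms by (fastforce simp: logic_of_def)+
  moreover have "\<phi> \<in> logic_of C" if "tautology \<phi>" for \<phi>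
    using taut[OF that] by (simp add: logic_of_def)
  moreover have "Imp (Box (Imp (Var 0) (Var 1))) (Imp (Box (Var 0)) (Box (Var 1))) \<in> logic_of C"
    using K by (simp add: logic_of_def)
  ultimately show ?thesis unfolding normal_logic_def by blast
qed

section \<open>Least normal extensions\<close>

lemma K_plus_least: "normal_logic L \<Longrightarrow> \<alpha> \<in> L \<Longrightarrow> K_plus \<alpha> \<subseteq> L"
  by (auto simp: K_plus_def)

lemma normal_logic_K_plus: "normal_logic (K_plus \<alpha>)"
proof -
  \<comment> \<open>Membership is tested in each normal logic above \<open>K_plus \<alpha>\<close>,
    so each closure property is inherited from those logics.\<close>
  have mem: "\<phi> \<in> K_plus \<alpha>" if "\<And>L. normal_logic L \<Longrightarrow> K_plus \<alpha> \<subseteq> L \<Longrightarrow> \<phi> \<in> L" for \<phi>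
    using that K_plus_least[of _ \<alpha>] unfolding K_plus_def by blast
  note D = normal_logicD
  show ?thesis
    unfolding normal_logic_def[of "K_plus \<alpha>"]
  proof (intro conjI allI impI)
    show "\<phi> \<in> K_plus \<alpha>" if "tautology \<phi>" for \<phi>
      by (rule mem) (rule prop_theory_tautology[OF D(1) that])
    show "Imp (Box (Imp (Var 0) (Var 1))) (Imp (Box (Var 0)) (Box (Var 1))) \<in> K_plus \<alpha>"
      by (rule mem) (rule D(4))
    show "\<psi> \<in> K_plus \<alpha>" if "Imp \<phi> \<psi> \<in> K_plus \<alpha>" "\<phi> \<in> K_plus \<alpha>" for \<phi> \<psi>
      by (rule mem) (meson D(1) prop_theory_mp subsetD that)
    show "subst \<sigma> \<phi> \<in> K_plus \<alpha>" if "\<phi> \<in> K_plus \<alpha>" for \<sigma> \<phi>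
      by (rule mem) (meson D(2) subsetD that)
    show "Box \<phi> \<in> K_plus \<alpha>" if "\<phi> \<in> K_plus \<alpha>" for \<phi>
      by (rule mem) (meson D(3) subsetD that)
  qed
qed

lemma axiom_in_K_plus: "\<alpha> \<in> K_plus \<alpha>"
  by (auto simp: K_plus_def)

section \<open>Correspondence, soundness and completeness combined\<close>

theorem theorem11:
  fixes v n :: nat and m :: "nat \<Rightarrow> fm" and x y :: int
  assumes "v \<ge> 1" and "n = 2 ^ v"
    and "minterm_enumeration v m"
    and "0 \<le> x" and "x \<le> int n - 1"
    and "-1 \<le> y" and "y \<le> int n - 1"
    and "x \<le> y + 1"
  shows "(\<forall>(W :: 'w set) R. frame W R \<longrightarrow>
            (valid W R (alpha_K n m x y) \<longleftrightarrow>
              (\<forall>w\<in>W. ((w, w) \<notin> R \<and> out_number R w \<le> X_bound n x y) \<or>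
                      ((w, w) \<in> R \<and> out_number R w \<le> Y_bound n y)))) \<and>
         (\<forall>(W :: 'w set) R. frame W R \<longrightarrow>
            (valid W R (alpha_D n m x y) \<longleftrightarrow>
              (\<forall>w\<in>W. ((w, w) \<notin> R \<and> Fin 1 \<le> out_number R w \<and> out_number R w \<le> X_bound n x y) \<or>
                      ((w, w) \<in> R \<and> out_number R w \<le> Y_bound n y)))) \<and>
         K_plus (alpha_K n m x y) \<subseteq> logic_of (frames_K n x y :: ('w set \<times> ('w \<times> 'w) set) set) \<and>
         K_plus (alpha_D n m x y) \<subseteq> logic_of (frames_D n x y :: ('w set \<times> ('w \<times> 'w) set) set) \<and>
         (infinite (UNIV :: 'w set) \<longrightarrow>
            K_plus (alpha_K n m x y) = logic_of (frames_K n x y :: ('w set \<times> ('w \<times> 'w) set) set) \<and>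
            K_plus (alpha_D n m x y) = logic_of (frames_D n x y :: ('w set \<times> ('w \<times> 'w) set) set))"
proof -
  let ?K = "alpha_K n m x y" and ?D = "alpha_D n m x y"
  let ?FK = "frames_K n x y :: ('w set \<times> ('w \<times> 'w) set) set"
  let ?FD = "frames_D n x y :: ('w set \<times> ('w \<times> 'w) set) set"
  note h = assms(3,2,4-8)
  have FK: "?FK = {(W, R). frame W R \<and> (\<forall>w\<in>W. out_bounded n x y R w)}"
    unfolding frames_K_def out_bounded_def ..
  have FD: "?FD = {(W, R). frame W R \<and> (\<forall>w\<in>W. out_bounded n x y R w \<and> R `` {w} \<noteq> {})}"
    unfolding frames_D_def out_bounded_serial ..
  have a: "valid W R ?K \<longleftrightarrow> (\<forall>w\<in>W. out_bounded n x y R w)" if F: "frame W R" for W :: "'w set" and R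
  proof
    assume val: "valid W R ?K"
    show "\<forall>w\<in>W. out_bounded n x y R w"
    proof
      fix w assume w: "w \<in> W"
      show "out_bounded n x y R w"
        by (rule sat_imp_out_bounded[OF h all_valuations_collapsing[OF F w]])
          (use val w in \<open>auto simp: valid_def\<close>)
    qed
  next
    show "\<forall>w\<in>W. out_bounded n x y R w \<Longrightarrow> valid W R ?K"
      by (auto simp: valid_def intro!: out_bounded_imp_sat[OF assms(3,2,8)])
  qed
  have split: "valid W R ?D \<longleftrightarrow> valid W R ?K \<and> valid W R (Dia Top)" for W :: "'w set" and R
    unfolding valid_def alpha_D_def sat.simps(3) by blast
  have serial: "valid W R (Dia Top) \<longleftrightarrow> (\<forall>w\<in>W. R `` {w} \<noteq> {})" for W :: "'w set" and R
    unfolding valid_def sat.simps by blast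
  have b: "valid W R ?D \<longleftrightarrow> (\<forall>w\<in>W. out_bounded n x y R w \<and> R `` {w} \<noteq> {})"
    if "frame W R" for W :: "'w set" and R
    unfolding split serial a[OF that] by blast
  have sound_K: "K_plus ?K \<subseteq> logic_of ?FK"
    by (intro K_plus_least normal_logic_logic_of) (auto simp: FK logic_of_def a)
  have sound_D: "K_plus ?D \<subseteq> logic_of ?FD"
    by (intro K_plus_least normal_logic_logic_of) (auto simp: FD logic_of_def b)
  have complete_K: "logic_of ?FK \<subseteq> K_plus ?K" if inf: "infinite (UNIV :: 'w set)"
  proof (rule subsetI, rule ccontr)
    fix \<phi> assume phi: "\<phi> \<in> logic_of ?FK" "\<phi> \<notin> K_plus ?K"
    obtain W :: "'w set" and R where "frame W R" "\<forall>w\<in>W. out_bounded n x y R w"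
      "Dia Top \<in> K_plus ?K \<longrightarrow> (\<forall>w\<in>W. R `` {w} \<noteq> {})" "\<not> valid W R \<phi>"
      by (rule countermodel[OF h normal_logic_K_plus axiom_in_K_plus phi(2) inf])
    with phi(1) show False by (auto simp: FK logic_of_def)
  qed
  \<comment> \<open>The conjuncts of \<open>?D\<close> follow by propositional reasoning, so the
    countermodel for this logic satisfies the K condition and is serial.\<close>
  have D_ax: "?K \<in> K_plus ?D" "Dia Top \<in> K_plus ?D"
  proof -
    have "Imp ?D ?K \<in> K_plus ?D" "Imp ?D (Dia Top) \<in> K_plus ?D"
      by (rule prop_theory_tautology[OF normal_logicD(1)[OF normal_logic_K_plus]],
          simp add: tautology_def alpha_D_def)+
    then show "?K \<in> K_plus ?D" "Dia Top \<in> K_plus ?D"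
      using prop_theory_mp[OF normal_logicD(1)[OF normal_logic_K_plus] _ axiom_in_K_plus] by blast+
  qed
  have complete_D: "logic_of ?FD \<subseteq> K_plus ?D" if inf: "infinite (UNIV :: 'w set)"
  proof (rule subsetI, rule ccontr)
    fix \<phi> assume phi: "\<phi> \<in> logic_of ?FD" "\<phi> \<notin> K_plus ?D"
    obtain W :: "'w set" and R where "frame W R" "\<forall>w\<in>W. out_bounded n x y R w"
      "Dia Top \<in> K_plus ?D \<longrightarrow> (\<forall>w\<in>W. R `` {w} \<noteq> {})" "\<not> valid W R \<phi>"
      by (rule countermodel[OF h normal_logic_K_plus D_ax(1) phi(2) inf])
    with phi(1) D_ax(2) show False by (auto simp: FD logic_of_def)
  qed
  show ?thesis
    unfolding out_bounded_serial out_bounded_def[symmetric]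
    by (intro conjI allI impI equalityI a b sound_K sound_D complete_K complete_D)
qed

end
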